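(* Let $L$ be an irreducible almost lower-triangular transition matrix on $\mathbb N$ with descent representation $(v,D)$. If the set of time-reversals of $L$ is not empty, then each of its elements $U$ can be represented as $$U_{a,b}=u_a\,\alpha_a\beta_b\,D_{b,a}\ \text{ for } b\ge a,\qquad U_{a,a-1}=1-u_a\ \text{ for } a\ge0,\ \text{ with } u_0=1,$$ where $[\pi,u,\alpha,\beta]$ is a 4-tuple of sequences (indexed by $\mathbb N$) which satisfies: (i) $\pi,u,\alpha,\beta$ are sequences of positive real numbers, except for $\beta_0$, which is $0$ if and only if $v_0=0$; moreover $u_0=1$ and $u_j\in(0,1)$ for $j\ge1$; (ii) $\sum_{b:\,b\ge a}\alpha_a\beta_bD_{b,a}=1$ for all $a\ge0$; (iii) $u_a\alpha_a=1/\pi_a$ and $\beta_b=\pi_bv_b$ for all $b\ge0$, $a\le b$; (iv) $\pi_a(1-v_a)=\pi_{a+1}(1-u_{a+1})$ for all $a\ge0$.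
   Context: $\mathbb N=\{0,1,2,\dots\}$. A transition matrix $L=[L_{i,j}]_{i,j\ge0}$ on $\mathbb N$ (non-negative entries, rows summing to $1$) is almost lower-triangular if $L_{i,j}>0\Rightarrow j\le i+1$. A descent kernel $D=[D_{i,j}]_{i,j\ge0}$ is a lower triangular transition matrix on $\mathbb N$: $D_{i,j}\ge 0$, $D_{i,j}>0\Rightarrow j\le i$, rows summing to $1$. The descent representation of $L$ is the pair $(v,D)$, with $v=(v_a,a\ge0)$ and $D$ a descent kernel, such that $L_{b,a}=v_bD_{b,a}$ for $b\ge a$ and $L_{b,b+1}=1-v_b$ for $b\ge0$; in the irreducible case the paper takes $v_0\in[0,1)$ and $v_a\in(0,1)$ for $a\ge1$. A transition matrix $U$ is a time-reversal of $L$ if there is a positive measure $\pi$ on $\mathbb N$ with $\pi_bL_{b,a}=\pi_aU_{a,b}$ for all $a,b$.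
   Formalization: Added hypothesis: for every a ≥ 1 there is b ≥ a with D_{b,a} > 0. It is necessary for (ii), and without it the claim fails: for L_{b,0} = L_{b,b+1} = 1/2 the time-reversal has U_{1,0} = 1, so u_1 = 0. *)

theory Defs
  imports "HOL-Analysis.Infinite_Sum"
begin

definition transition_matrix :: "(nat \<Rightarrow> nat \<Rightarrow> real) \<Rightarrow> bool" where
  "transition_matrix M \<longleftrightarrow> (\<forall>i j. 0 \<le> M i j) \<and> (\<forall>i. (M i has_sum 1) UNIV)"

definition almost_lower_triangular :: "(nat \<Rightarrow> nat \<Rightarrow> real) \<Rightarrow> bool" where
  "almost_lower_triangular L \<longleftrightarrow> (\<forall>i j. L i j > 0 \<longrightarrow> j \<le> i + 1)"

definition descent_kernel :: "(nat \<Rightarrow> nat \<Rightarrow> real) \<Rightarrow> bool" where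
  "descent_kernel D \<longleftrightarrow> transition_matrix D \<and> (\<forall>i j. D i j > 0 \<longrightarrow> j \<le> i)"

primrec matrix_pow :: "(nat \<Rightarrow> nat \<Rightarrow> real) \<Rightarrow> nat \<Rightarrow> nat \<Rightarrow> nat \<Rightarrow> real" where
  "matrix_pow M 0 = (\<lambda>i j. if i = j then 1 else 0)"
| "matrix_pow M (Suc n) = (\<lambda>i j. \<Sum>\<^sub>\<infinity>k. M i k * matrix_pow M n k j)"

definition irreducible_matrix :: "(nat \<Rightarrow> nat \<Rightarrow> real) \<Rightarrow> bool" where
  "irreducible_matrix M \<longleftrightarrow> (\<forall>i j. \<exists>n. matrix_pow M n i j > 0)"

definition descent_representation ::
  "(nat \<Rightarrow> nat \<Rightarrow> real) \<Rightarrow> (nat \<Rightarrow> real) \<Rightarrow> (nat \<Rightarrow> nat \<Rightarrow> real) \<Rightarrow> bool" where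
  "descent_representation L v D \<longleftrightarrow>
     descent_kernel D \<and>
     (\<forall>b a. a \<le> b \<longrightarrow> L b a = v b * D b a) \<and>
     (\<forall>b. L b (b + 1) = 1 - v b)"

text \<open>
  A positive measure is a non-negative, non-zero one. For irreducible \<open>L\<close> this is no more general
  than requiring \<open>\<pi> a > 0\<close> for every \<open>a\<close>: the balance equations propagate positivity along the
  paths of \<open>L\<close>.
\<close>

definition time_reversals :: "(nat \<Rightarrow> nat \<Rightarrow> real) \<Rightarrow> (nat \<Rightarrow> nat \<Rightarrow> real) set" where
  "time_reversals L =
     {U. transition_matrix U \<and>
         (\<exists>\<pi>. (\<forall>a. 0 \<le> \<pi> a) \<and> (\<exists>a. \<pi> a \<noteq> 0) \<and>
              (\<forall>a b. \<pi> b * L b a = \<pi> a * U a b))}"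

end

theory Submission
  imports Defs
begin

text \<open>
  The balance equations \<open>\<pi>\<^sub>b L\<^sub>b\<^sub>a = \<pi>\<^sub>a U\<^sub>a\<^sub>b\<close> determine \<open>U\<close> from \<open>L\<close> and \<open>\<pi>\<close> as soon as \<open>\<pi>\<close> vanishes
  nowhere, and they exchange the two triangles: since \<open>L\<close> jumps up by at most one, \<open>U\<close> jumps down by
  at most one, and the descents \<open>L\<^sub>b\<^sub>a = v\<^sub>b D\<^sub>b\<^sub>a\<close> become the ascents \<open>U\<^sub>a\<^sub>b = \<pi>\<^sub>b v\<^sub>b D\<^sub>b\<^sub>a / \<pi>\<^sub>a\<close>. Let
  \<open>u\<^sub>a\<close> be the probability that \<open>U\<close> does not step down from \<open>a\<close>. Taking \<open>\<beta>\<^sub>b = \<pi>\<^sub>b v\<^sub>b\<close> and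
  \<open>\<alpha>\<^sub>a = 1 / (\<pi>\<^sub>a u\<^sub>a)\<close> then gives the claimed factorisation, and (ii) says that row \<open>a\<close> of \<open>U\<close>
  conditioned on not stepping down has total mass one.

  What remains is positivity. Irreducibility of \<open>L\<close> propagates positivity of \<open>\<pi>\<close> from one state to
  all of them (\<open>reversing_measure_positive\<close>). For \<open>a \<ge> 1\<close>, the step up of \<open>L\<close> from \<open>a - 1\<close> to \<open>a\<close> has positive
  probability, so \<open>U\<close> steps down from \<open>a\<close> with positive probability and \<open>u\<^sub>a < 1\<close>. A positive
  entry in column \<open>a\<close> of \<open>D\<close>, in a row \<open>b \<ge> a\<close> where \<open>v\<^sub>b > 0\<close>, is a positive descent of \<open>L\<close> into
  \<open>a\<close>, hence a positive ascent of \<open>U\<close> from \<open>a\<close>, so \<open>u\<^sub>a > 0\<close>.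
\<close>

text \<open>A positive entry of a power of a non-negative matrix is witnessed by a path of positive
  entries of the matrix, so any property that is passed along positive entries is passed along such a path.\<close>

lemma matrix_pow_positive_propagates:
  assumes nonneg: "\<And>i j. 0 \<le> M i j"
    and step: "\<And>i j. P i \<Longrightarrow> M i j > 0 \<Longrightarrow> P j"
  shows "P i \<Longrightarrow> matrix_pow M n i j > 0 \<Longrightarrow> P j"
proof (induction n arbitrary: i)
  case 0
  then show ?case by (simp split: if_splits)
next
  case (Suc n)
  have "\<exists>k. M i k * matrix_pow M n k j > 0"
  proof (rule ccontr)
    assume "\<not> ?thesis"
    then have "0 \<le> (\<Sum>\<^sub>\<infinity>k. - (M i k * matrix_pow M n k j))"
      by (intro infsum_nonneg) (auto simp: not_less)
    with Suc.prems(2) show False by (simp add: infsum_uminus)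
  qed
  then obtain k where "M i k * matrix_pow M n k j > 0" by blast
  then have "M i k > 0" "matrix_pow M n k j > 0"
    using nonneg[of i k] by (auto simp: zero_less_mult_iff)
  with step Suc.IH Suc.prems(1) show ?case by blast
qed

text \<open>If \<open>\<pi>\<^sub>i L\<^sub>i\<^sub>j > 0\<close> then also \<open>\<pi>\<^sub>j U\<^sub>j\<^sub>i > 0\<close>, which excludes \<open>\<pi>\<^sub>j = 0\<close>: positivity of \<open>\<pi>\<close> follows
  the transitions of \<open>L\<close>, and by irreducibility these lead everywhere.\<close>

lemma reversing_measure_positive:
  fixes \<pi> :: "nat \<Rightarrow> real"
  assumes L: "transition_matrix L" "irreducible_matrix L"
    and nonneg: "\<And>a. 0 \<le> \<pi> a" and nonzero: "\<pi> c \<noteq> 0"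
    and balance: "\<And>a b. \<pi> b * L b a = \<pi> a * U a b"
  shows "0 < \<pi> a"
proof -
  have step: "0 < \<pi> j" if "0 < \<pi> i" "L i j > 0" for i j
  proof -
    have "\<pi> j * U j i > 0"
      using balance[of i j] that by (metis mult_pos_pos)
    then have "\<pi> j \<noteq> 0" by auto
    with nonneg[of j] show ?thesis by simp
  qed
  obtain n where "matrix_pow L n c a > 0"
    using L(2) by (auto simp: irreducible_matrix_def)
  moreover have "0 < \<pi> c" using nonneg[of c] nonzero by simp
  moreover have "0 \<le> L i j" for i j
    using L(1) by (simp add: transition_matrix_def)
  ultimately show ?thesis
    using matrix_pow_positive_propagates[of L "\<lambda>i. 0 < \<pi> i"] step by blast
qed

lemma almost_upper_triangular_row_has_sum:
  assumes U: "transition_matrix U" and upper: "\<And>b. b + 1 < a \<Longrightarrow> U a b = 0"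
  shows "(U a has_sum (if a = 0 then 1 else 1 - U a (a - 1))) {a..}"
proof -
  have "(\<Sum>b<a. U a b) = (if a = 0 then 0 else U a (a - 1))"
    using upper by (cases a) (auto intro!: sum.neutral)
  then have "(U a has_sum (if a = 0 then 0 else U a (a - 1))) {..<a}"
    by (metis finite_lessThan has_sum_finite)
  moreover have "(U a has_sum 1) UNIV"
    using U by (simp add: transition_matrix_def)
  ultimately have "(U a has_sum (1 - (if a = 0 then 0 else U a (a - 1)))) (UNIV - {..<a})"
    by (intro has_sum_Diff) auto
  moreover have "UNIV - {..<a} = {a..}" by auto
  ultimately show ?thesis by (simp split: if_splits)
qed

theorem proposition3p7:
  fixes L D :: "nat \<Rightarrow> nat \<Rightarrow> real" and v :: "nat \<Rightarrow> real"
  assumes "transition_matrix L"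
    and "almost_lower_triangular L"
    and "irreducible_matrix L"
    and "descent_representation L v D"
    and "0 \<le> v 0" and "v 0 < 1" and "\<forall>a\<ge>1. 0 < v a \<and> v a < 1"
    and nondegenerate: "\<forall>a\<ge>1. \<exists>b\<ge>a. D b a > 0"
    and "time_reversals L \<noteq> {}"
  shows "\<forall>U\<in>time_reversals L. \<exists>\<pi> u \<alpha> \<beta> :: nat \<Rightarrow> real.
      (\<forall>a b. a \<le> b \<longrightarrow> U a b = u a * \<alpha> a * \<beta> b * D b a) \<and>
      (\<forall>a\<ge>1. U a (a - 1) = 1 - u a) \<and>
      (\<forall>a b. b + 1 < a \<longrightarrow> U a b = 0) \<and>
      (\<forall>j. 0 < \<pi> j) \<and> (\<forall>j. 0 < u j) \<and> (\<forall>j. 0 < \<alpha> j) \<and> (\<forall>j\<ge>1. 0 < \<beta> j) \<and>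
      0 \<le> \<beta> 0 \<and> (\<beta> 0 = 0 \<longleftrightarrow> v 0 = 0) \<and>
      u 0 = 1 \<and> (\<forall>j\<ge>1. 0 < u j \<and> u j < 1) \<and>
      (\<forall>a. ((\<lambda>b. \<alpha> a * \<beta> b * D b a) has_sum 1) {a..}) \<and>
      (\<forall>b. \<forall>a\<le>b. u a * \<alpha> a = 1 / \<pi> a \<and> \<beta> b = \<pi> b * v b) \<and>
      (\<forall>a. \<pi> a * (1 - v a) = \<pi> (a + 1) * (1 - u (a + 1)))"
proof
  fix U assume "U \<in> time_reversals L"
  then obtain \<pi> c where U: "transition_matrix U"
    and \<pi>: "\<And>a. 0 \<le> \<pi> a" "\<pi> c \<noteq> 0" "\<And>a b. \<pi> b * L b a = \<pi> a * U a b"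
    unfolding time_reversals_def by blast
  have pos: "0 < \<pi> a" for a
    by (rule reversing_measure_positive[OF assms(1,3) \<pi>])
  have U_nonneg: "0 \<le> U a b" for a b
    using U by (simp add: transition_matrix_def)
  have U_eq: "U a b = \<pi> b * L b a / \<pi> a" for a b
    using \<pi>(3)[of b a] pos[of a] by simp
  have v_less: "v a < 1" for a
    using assms(6,7) by (cases a) auto
  have L_desc: "L b a = v b * D b a" if "a \<le> b" for a b
    using assms(4) that by (simp add: descent_representation_def)
  have L_asc: "L b (Suc b) = 1 - v b" for b
    using assms(4) by (simp add: descent_representation_def)
  have upper: "U a b = 0" if "b + 1 < a" for a b
  proof -
    have "0 \<le> L b a" using assms(1) by (simp add: transition_matrix_def)
    moreover have "\<not> L b a > 0"
      using assms(2) that by (force simp: almost_lower_triangular_def)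
    ultimately show ?thesis by (simp add: U_eq)
  qed
  define u where "u a = (if a = 0 then 1 else 1 - U a (a - 1))" for a
  define \<beta> where "\<beta> b = \<pi> b * v b" for b
  define \<alpha> where "\<alpha> a = 1 / (\<pi> a * u a)" for a
  have row: "(U a has_sum u a) {a..}" for a
    unfolding u_def by (rule almost_upper_triangular_row_has_sum[OF U upper])
  have u_pos: "0 < u a" for a
  proof (cases "a = 0")
    case False
    with nondegenerate obtain b where b: "b \<ge> a" "D b a > 0"
      by (metis One_nat_def Suc_leI neq0_conv)
    then have "v b > 0" using assms(7) False by auto
    then have "U a b > 0"
      using b pos by (simp add: U_eq L_desc)
    also have "U a b \<le> u a"
      using has_sum_mono2[OF has_sum_finite[of "{b}" "U a"] row[of a]] b U_nonneg by simp
    finally show ?thesis .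
  qed (simp add: u_def)
  have balance_up: "\<pi> a * (1 - v a) = \<pi> (Suc a) * (1 - u (Suc a))" for a
    using \<pi>(3)[of a "Suc a"] by (simp add: L_asc u_def)
  have u_less: "u a < 1" if "1 \<le> a" for a
  proof -
    obtain a' where a: "a = Suc a'" using \<open>1 \<le> a\<close> by (cases a) auto
    have "0 < \<pi> a' * (1 - v a')" using pos v_less by simp
    then show ?thesis
      using pos[of a] by (simp add: a balance_up zero_less_mult_iff)
  qed
  have u_\<alpha>: "u a * \<alpha> a = 1 / \<pi> a" for a
    using u_pos[of a] by (simp add: \<alpha>_def)
  have factor: "U a b = u a * \<alpha> a * \<beta> b * D b a" if "a \<le> b" for a b
    using that by (simp add: U_eq L_desc u_\<alpha> \<beta>_def)
  have mass: "((\<lambda>b. \<alpha> a * \<beta> b * D b a) has_sum 1) {a..}" for a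
  proof -
    have "((\<lambda>b. U a b / u a) has_sum (u a / u a)) {a..}"
      using has_sum_cmult_left[OF row[of a], of "1 / u a"] by simp
    moreover have "U a b / u a = \<alpha> a * \<beta> b * D b a" if "b \<in> {a..}" for b
      using that u_pos[of a] by (simp add: factor)
    ultimately have "((\<lambda>b. \<alpha> a * \<beta> b * D b a) has_sum (u a / u a)) {a..}"
      by (rule has_sum_cong[THEN iffD1, rotated])
    then show ?thesis using u_pos[of a] by simp
  qed
  have \<alpha>_pos: "0 < \<alpha> a" for a
    using pos u_pos by (simp add: \<alpha>_def)
  have \<beta>_pos: "0 < \<beta> b" if "1 \<le> b" for b
    using pos assms(7) that by (simp add: \<beta>_def)
  have \<beta>_0: "0 \<le> \<beta> 0" "\<beta> 0 = 0 \<longleftrightarrow> v 0 = 0"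
    using pos[of 0] assms(5) by (auto simp: \<beta>_def)
  have down: "U a (a - 1) = 1 - u a" if "1 \<le> a" for a
    using that by (simp add: u_def)
  have u_0: "u 0 = 1" by (simp add: u_def)
  show "\<exists>\<pi> u \<alpha> \<beta> :: nat \<Rightarrow> real.
      (\<forall>a b. a \<le> b \<longrightarrow> U a b = u a * \<alpha> a * \<beta> b * D b a) \<and>
      (\<forall>a\<ge>1. U a (a - 1) = 1 - u a) \<and>
      (\<forall>a b. b + 1 < a \<longrightarrow> U a b = 0) \<and>
      (\<forall>j. 0 < \<pi> j) \<and> (\<forall>j. 0 < u j) \<and> (\<forall>j. 0 < \<alpha> j) \<and> (\<forall>j\<ge>1. 0 < \<beta> j) \<and>
      0 \<le> \<beta> 0 \<and> (\<beta> 0 = 0 \<longleftrightarrow> v 0 = 0) \<and>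
      u 0 = 1 \<and> (\<forall>j\<ge>1. 0 < u j \<and> u j < 1) \<and>
      (\<forall>a. ((\<lambda>b. \<alpha> a * \<beta> b * D b a) has_sum 1) {a..}) \<and>
      (\<forall>b. \<forall>a\<le>b. u a * \<alpha> a = 1 / \<pi> a \<and> \<beta> b = \<pi> b * v b) \<and>
      (\<forall>a. \<pi> a * (1 - v a) = \<pi> (a + 1) * (1 - u (a + 1)))"
  proof (rule exI[of _ \<pi>], rule exI[of _ u], rule exI[of _ \<alpha>], rule exI[of _ \<beta>],
      intro conjI allI impI)
    show "\<beta> b = \<pi> b * v b" for b by (rule \<beta>_def)
    show "U a b = u a * \<alpha> a * \<beta> b * D b a" if "a \<le> b" for a b
      using that by (rule factor)
    show "\<pi> a * (1 - v a) = \<pi> (a + 1) * (1 - u (a + 1))" for a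
      by (simp add: balance_up)
  qed (simp_all add: down upper pos u_pos \<alpha>_pos \<beta>_pos \<beta>_0 u_0 u_less mass u_\<alpha> del: One_nat_def)
qed

end
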